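(* Assume that one evaluation of $f$ costs $T_f=O(1)$ queries. Then the query complexity of the problem $LSEG(f,n)$ (find an empty segment of the largest length, for $f:\{0,\dots,n-1\}\to\{0,1\}$) is $\Omega(n)$ in the classical (deterministic or randomized) case and $\Omega(\sqrt{n})$ in the quantum case.
   Context: Problem $LSEG(f,n)$ (Largest Empty Segment): given $f:\{0,\dots,n-1\}\to\{0,1\}$, a pair $(l,r)$ with $0\le l\le r\le n-1$ is an empty segment if $f(i)=0$ for all $l\le i\le r$; its length is $r-l+1$. The goal is to output an empty segment $(l,r)$ such that no empty segment $(l',r')$ has $r'-l'+1>r-l+1$ (if there is no empty segment, output $(NULL,NULL)$). Query model: the input is the table of values of $f$, and a query reveals one value $f(i)$. In the quantum case a query is one application of the unitary $|i\rangle|z\rangle|w\rangle\mapsto|i\rangle|z+f(i) \bmod 2\rangle|w\rangle$, interleaved with arbitrary input-independent unitaries and followed by a final measurement. The (randomized or quantum) query complexity of the problem is the smallest worst-case number of queries of an algorithm that, on every input, outputs a correct answer with probability at least $2/3$. *)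

theory Defs
  imports
    "HOL-Probability.Probability_Mass_Function"
    "HOL-Library.Landau_Symbols"
    "Jordan_Normal_Form.Schur_Decomposition"
begin

hide_const (open) Finite_Cartesian_Product.vec Finite_Cartesian_Product.mat
  Finite_Cartesian_Product.row Finite_Cartesian_Product.column
no_notation Finite_Cartesian_Product.vec_nth (infixl \<open>$\<close> 90)

section \<open>The largest empty segment problem\<close>

definition inputs :: "nat \<Rightarrow> (nat \<Rightarrow> nat) set" where
  "inputs n = {..<n} \<rightarrow>\<^sub>E {0, 1}"

definition empty_segment :: "nat \<Rightarrow> (nat \<Rightarrow> nat) \<Rightarrow> nat \<Rightarrow> nat \<Rightarrow> bool" where
  "empty_segment n f l r \<longleftrightarrow> l \<le> r \<and> r < n \<and> (\<forall>i. l \<le> i \<and> i \<le> r \<longrightarrow> f i = 0)"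

definition seg_length :: "nat \<Rightarrow> nat \<Rightarrow> nat" where
  "seg_length l r = r - l + 1"

text \<open>The value \<^term>\<open>None\<close> stands for the output (NULL, NULL).\<close>

type_synonym answer = "(nat \<times> nat) option"

definition lseg_correct :: "nat \<Rightarrow> (nat \<Rightarrow> nat) \<Rightarrow> answer \<Rightarrow> bool" where
  "lseg_correct n f a \<longleftrightarrow>
     (case a of
        None \<Rightarrow> \<not> (\<exists>l r. empty_segment n f l r)
      | Some (l, r) \<Rightarrow> empty_segment n f l r \<and>
          \<not> (\<exists>l' r'. empty_segment n f l' r' \<and> seg_length l' r' > seg_length l r))"


section \<open>Classical query algorithms\<close>

text \<open>
  A deterministic query algorithm is a decision tree: \<open>Query i t0 t1\<close> evaluates \<open>f i\<close> and
  continues with \<open>t0\<close> if the value is 0 and with \<open>t1\<close> otherwise.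
\<close>

datatype dtree = Output answer | Query nat dtree dtree

primrec dtree_on :: "nat \<Rightarrow> dtree \<Rightarrow> bool" where
  "dtree_on n (Output a) \<longleftrightarrow> True"
| "dtree_on n (Query i t0 t1) \<longleftrightarrow> i < n \<and> dtree_on n t0 \<and> dtree_on n t1"

primrec run :: "dtree \<Rightarrow> (nat \<Rightarrow> nat) \<Rightarrow> answer" where
  "run (Output a) f = a"
| "run (Query i t0 t1) f = (if f i = 0 then run t0 f else run t1 f)"

primrec evaluations :: "dtree \<Rightarrow> (nat \<Rightarrow> nat) \<Rightarrow> nat" where
  "evaluations (Output a) f = 0"
| "evaluations (Query i t0 t1) f =
     Suc (if f i = 0 then evaluations t0 f else evaluations t1 f)"

text \<open>
  In the three complexity measures below, \<open>c\<close> is the number of queries charged for one evaluation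
  of \<open>f\<close>; the pure query model is \<open>c = 1\<close>.
\<close>

definition det_query_complexity :: "nat \<Rightarrow> nat \<Rightarrow> nat" where
  "det_query_complexity c n =
     (LEAST q. \<exists>t. dtree_on n t \<and>
        (\<forall>f\<in>inputs n. lseg_correct n f (run t f)) \<and>
        (\<forall>f\<in>inputs n. c * evaluations t f \<le> q))"

text \<open>
  A randomized algorithm is a probability distribution over decision trees (there are only
  countably many of these).  Its worst-case number of queries is taken over all inputs and all
  outcomes of the internal randomness.
\<close>

definition rand_query_complexity :: "nat \<Rightarrow> nat \<Rightarrow> nat" where
  "rand_query_complexity c n =
     (LEAST q. \<exists>p :: dtree pmf. (\<forall>t\<in>set_pmf p. dtree_on n t) \<and>
        (\<forall>f\<in>inputs n. measure_pmf.prob p {t. lseg_correct n f (run t f)} \<ge> 2 / 3) \<and>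
        (\<forall>t\<in>set_pmf p. \<forall>f\<in>inputs n. c * evaluations t f \<le> q))"


section \<open>Quantum query algorithms\<close>

text \<open>
  The state space has basis \<open>|i\<rangle>|z\<rangle>|w\<rangle>\<close> with \<open>i < n\<close>, \<open>z < 2\<close>, \<open>w < m\<close>, where \<open>m\<close> is the dimension
  of the workspace.  It is identified with the space of complex vectors of dimension \<open>n * 2 * m\<close>
  by the lexicographic enumeration \<open>basis_index m i z w\<close> of these triples.
\<close>

definition qdim :: "nat \<Rightarrow> nat \<Rightarrow> nat" where
  "qdim n m = n * 2 * m"

definition basis_index :: "nat \<Rightarrow> nat \<Rightarrow> nat \<Rightarrow> nat \<Rightarrow> nat" where
  "basis_index m i z w = (i * 2 + z) * m + w"

definition query_op :: "nat \<Rightarrow> nat \<Rightarrow> (nat \<Rightarrow> nat) \<Rightarrow> complex mat" where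
  "query_op n m f = mat (qdim n m) (qdim n m)
     (\<lambda>(a, b). if \<exists>i<n. \<exists>z<2. \<exists>w<m. b = basis_index m i z w \<and>
                        a = basis_index m i ((z + f i) mod 2) w
               then 1 else 0)"

definition unitary_mat :: "nat \<Rightarrow> complex mat \<Rightarrow> bool" where
  "unitary_mat N U \<longleftrightarrow> U \<in> carrier_mat N N \<and>
     mat_adjoint U * U = 1\<^sub>m N \<and> U * mat_adjoint U = 1\<^sub>m N"

text \<open>
  Alternating application of \<open>U 0\<close>, \<dots>, \<open>U k\<close> and \<open>k\<close> queries, starting with \<open>U 0\<close> on the
  basis state with all three registers 0.
\<close>

primrec qstate :: "nat \<Rightarrow> nat \<Rightarrow> (nat \<Rightarrow> complex mat) \<Rightarrow> (nat \<Rightarrow> nat) \<Rightarrow> nat \<Rightarrow> complex vec" where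
  "qstate n m U f 0 = U 0 *\<^sub>v unit_vec (qdim n m) (basis_index m 0 0 0)"
| "qstate n m U f (Suc k) = U (Suc k) *\<^sub>v (query_op n m f *\<^sub>v qstate n m U f k)"

text \<open>
  Probability that measuring the state \<open>v\<close> in the computational basis and reporting \<open>out b\<close> for the
  observed basis state \<open>b\<close> gives a correct output.  Any other final measurement can be brought
  to this form by enlarging the workspace and changing the last unitary.
\<close>

definition success_prob :: "nat \<Rightarrow> (nat \<Rightarrow> nat) \<Rightarrow> (nat \<Rightarrow> answer) \<Rightarrow> complex vec \<Rightarrow> real" where
  "success_prob n f out v =
     (\<Sum>b | b < dim_vec v \<and> lseg_correct n f (out b). (cmod (v $ b))\<^sup>2)"

definition quantum_query_complexity :: "nat \<Rightarrow> nat \<Rightarrow> nat" where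
  "quantum_query_complexity c n =
     (LEAST q. \<exists>m k U out. (\<forall>j\<le>k. unitary_mat (qdim n m) (U j)) \<and>
        (\<forall>f\<in>inputs n. success_prob n f out (qstate n m U f k) \<ge> 2 / 3) \<and>
        c * k \<le> q)"

subsection \<open>The query operator acts as \<open>|i\<rangle>|z\<rangle>|w\<rangle> \<mapsto> |i\<rangle>|z + f i mod 2\<rangle>|w\<rangle>\<close>\<close>

lemma basis_index_less:
  assumes "i < n" "z < 2" "w < m"
  shows "basis_index m i z w < qdim n m"
proof -
  have "basis_index m i z w < (i * 2 + z + 1) * m"
    using assms by (simp add: basis_index_def algebra_simps)
  also have "\<dots> \<le> (n * 2) * m"
    using assms by (intro mult_le_mono1) simp
  finally show ?thesis by (simp add: qdim_def)
qed

lemma basis_index_inject: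
  assumes "z < 2" "w < m" "z' < 2" "w' < m"
  shows "basis_index m i z w = basis_index m i' z' w' \<longleftrightarrow> i = i' \<and> z = z' \<and> w = w'"
proof
  assume eq: "basis_index m i z w = basis_index m i' z' w'"
  have "basis_index m i z w mod m = w" "basis_index m i' z' w' mod m = w'"
    "basis_index m i z w div m = i * 2 + z" "basis_index m i' z' w' div m = i' * 2 + z'"
    using assms by (simp_all add: basis_index_def)
  with eq have "w = w'" "i * 2 + z = i' * 2 + z'" by simp_all
  then show "i = i' \<and> z = z' \<and> w = w'" using assms by presburger
qed simp

lemma query_op_unit_vec:
  assumes "i < n" "z < 2" "w < m"
  shows "query_op n m f *\<^sub>v unit_vec (qdim n m) (basis_index m i z w) =
         unit_vec (qdim n m) (basis_index m i ((z + f i) mod 2) w)"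
proof (rule eq_vecI)
  fix a assume "a < dim_vec (unit_vec (qdim n m) (basis_index m i ((z + f i) mod 2) w) :: complex vec)"
  then have a: "a < qdim n m" by simp
  have b: "basis_index m i z w < qdim n m"
    using assms by (rule basis_index_less)
  have "(query_op n m f *\<^sub>v unit_vec (qdim n m) (basis_index m i z w)) $ a =
        query_op n m f $$ (a, basis_index m i z w)"
    using a b by (simp add: query_op_def)
  also have "\<dots> = (if a = basis_index m i ((z + f i) mod 2) w then 1 else 0)"
    using a b assms by (auto simp: query_op_def basis_index_inject)
  finally show "(query_op n m f *\<^sub>v unit_vec (qdim n m) (basis_index m i z w)) $ a =
        unit_vec (qdim n m) (basis_index m i ((z + f i) mod 2) w) $ a"
    using a by (simp add: unit_vec_def)
qed (simp add: query_op_def)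

end

theory Submission
  imports Defs
begin

text \<open>
  Both lower bounds come from distinguishing the zero input, whose only correct answer is the whole
  interval, from the inputs with a single 1, for which that answer is wrong. A classical tree that
  answers differently on the input with a 1 at \<open>j\<close> must query \<open>j\<close> on the zero input, so each \<open>j\<close> is
  queried there with probability at least 1/3, and summing over \<open>j\<close> bounds the expected number of
  queries from below by \<open>n / 3\<close>. In the quantum case the final states on the two inputs are at distance at least
  \<open>d = sqrt (2/3) - sqrt (1/3)\<close>, while by the hybrid argument of Bennett, Bernstein, Brassard and
  Vazirani this distance is at most twice the sum, over the \<open>k\<close> queries on the zero input, of the
  amplitude at index \<open>j\<close>; Cauchy-Schwarz and summation over \<open>j\<close> give \<open>n d^2 \<le> 4 k^2\<close>.

  As the complexities are defined by \<open>LEAST\<close>, which is unspecified for an empty predicate, the lower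
  bounds also need that correct algorithms exist. In the quantum case this is an exact algorithm
  that reads the whole input using permutation matrices.
\<close>

section \<open>Hard instances\<close>

definition zero_input :: "nat \<Rightarrow> nat \<Rightarrow> nat" where
  "zero_input n = (\<lambda>i\<in>{..<n}. 0)"

definition point_input :: "nat \<Rightarrow> nat \<Rightarrow> nat \<Rightarrow> nat" where
  "point_input n j = (\<lambda>i\<in>{..<n}. if i = j then 1 else 0)"

lemma zero_input_in_inputs: "zero_input n \<in> inputs n"
  by (auto simp: zero_input_def inputs_def)

lemma point_input_in_inputs: "point_input n j \<in> inputs n"
  by (auto simp: point_input_def inputs_def)

lemma lseg_correct_zero_input:
  assumes "lseg_correct n (zero_input n) a" "n > 0"
  shows "a = Some (0, n - 1)"
proof -
  have whole: "empty_segment n (zero_input n) 0 (n - 1)"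
    using \<open>n > 0\<close> by (auto simp: empty_segment_def zero_input_def)
  show ?thesis
  proof (cases a)
    case None
    then show ?thesis using assms whole by (auto simp: lseg_correct_def)
  next
    case (Some p)
    obtain l r where p: "p = (l, r)" by force
    have "empty_segment n (zero_input n) l r" "\<not> seg_length 0 (n - 1) > seg_length l r"
      using assms(1) whole by (auto simp: lseg_correct_def Some p)
    then have "l = 0" "r = n - 1"
      using \<open>n > 0\<close> by (auto simp: empty_segment_def seg_length_def)
    then show ?thesis by (simp add: Some p)
  qed
qed

lemma not_lseg_correct_point_input:
  assumes "j < n"
  shows "\<not> lseg_correct n (point_input n j) (Some (0, n - 1))"
  using assms by (auto simp: lseg_correct_def empty_segment_def point_input_def)

lemma lseg_correct_exists: "\<exists>a. lseg_correct n f a"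
proof (cases "\<exists>l r. empty_segment n f l r")
  case False
  then have "lseg_correct n f None" by (simp add: lseg_correct_def)
  then show ?thesis ..
next
  case True
  \<comment> \<open>Segments are treated as pairs, since the existence of a maximum is applied to
    one variable; lengths are at most \<open>n\<close>, and the strict bound it asks for is
    \<open>Suc n\<close>.\<close>
  then obtain l r where lr: "case_prod (empty_segment n f) (l, r)" by auto
  have "\<forall>p. case_prod (empty_segment n f) p \<longrightarrow> case_prod seg_length p < Suc n"
    by (auto simp: empty_segment_def seg_length_def)
  from ex_has_greatest_nat[OF lr this] obtain l' r' where "empty_segment n f l' r'"
    "\<forall>l r. empty_segment n f l r \<longrightarrow> seg_length l r \<le> seg_length l' r'"
    by auto
  then have "lseg_correct n f (Some (l', r'))"
    by (auto simp: lseg_correct_def not_less)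
  then show ?thesis ..
qed


section \<open>Classical algorithms\<close>

text \<open>The tree asks the positions from \<open>k - 1\<close> down to 0. The output function
  \<open>h\<close> varies in the induction, so that the first answer \<open>b\<close> can be
  absorbed into it: the subtree for \<open>b\<close> computes
  \<open>\<lambda>g. h (g(k := b))\<close>.\<close>

lemma full_dtree_exists:
  assumes "k \<le> n"
  shows "\<exists>t. dtree_on n t \<and> (\<forall>f\<in>inputs n. run t f = h (restrict f {..<k})) \<and>
    (\<forall>f. evaluations t f \<le> k)"
  using assms
proof (induction k arbitrary: h)
  case 0
  show ?case by (rule exI[of _ "Output (h (restrict undefined {..<0}))"]) (simp add: restrict_def)
next
  case (Suc k)
  have "\<exists>t. dtree_on n t \<and> (\<forall>f\<in>inputs n. run t f = h ((restrict f {..<k})(k := b))) \<and>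
      (\<forall>f. evaluations t f \<le> k)" for b
    using Suc.IH[of "\<lambda>g. h (g(k := b))"] Suc.prems by (simp del: restrict_apply)
  then obtain t where t: "\<And>b. dtree_on n (t b)"
      "\<And>b f. f \<in> inputs n \<Longrightarrow> run (t b) f = h ((restrict f {..<k})(k := b))"
      "\<And>b f. evaluations (t b) f \<le> k"
    by metis
  have split: "(restrict f {..<k})(k := f k) = restrict f {..<Suc k}" for f :: "nat \<Rightarrow> nat"
    by (auto simp: restrict_def fun_eq_iff less_Suc_eq)
  have "f k \<in> {0, 1}" if "f \<in> inputs n" for f
    using that Suc.prems by (auto simp: inputs_def PiE_iff)
  then have "run (Query k (t 0) (t 1)) f = h (restrict f {..<Suc k})" if "f \<in> inputs n" for f
    using that t(2)[OF that] split[of f] by fastforce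
  then show ?case
    using Suc.prems t(1,3) by (intro exI[of _ "Query k (t 0) (t 1)"]) (auto simp del: restrict_apply)
qed

lemma deterministic_algorithm_exists:
  "\<exists>q t. dtree_on n t \<and> (\<forall>f\<in>inputs n. lseg_correct n f (run t f)) \<and>
     (\<forall>f\<in>inputs n. c * evaluations t f \<le> q)"
proof -
  define h where "h f = (SOME a. lseg_correct n f a)" for f
  have h: "lseg_correct n f (h f)" for f
    unfolding h_def by (rule someI_ex) (rule lseg_correct_exists)
  obtain t where t: "dtree_on n t" "\<And>f. f \<in> inputs n \<Longrightarrow> run t f = h (restrict f {..<n})"
    "\<And>f. evaluations t f \<le> n"
    using full_dtree_exists[of n n h] by auto
  have "restrict f {..<n} = f" if "f \<in> inputs n" for f
    using that unfolding inputs_def by (rule PiE_restrict)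
  then have "\<forall>f\<in>inputs n. lseg_correct n f (run t f)" using t(2) h by simp
  then show ?thesis
    using t(1,3) by (intro exI[of _ "c * n"] exI[of _ t]) auto
qed

section \<open>Queried positions and the classical lower bound\<close>

primrec queried :: "dtree \<Rightarrow> (nat \<Rightarrow> nat) \<Rightarrow> nat set" where
  "queried (Output a) f = {}"
| "queried (Query i t0 t1) f = insert i (if f i = 0 then queried t0 f else queried t1 f)"

lemma card_queried_le: "finite (queried t f) \<and> card (queried t f) \<le> evaluations t f"
proof (induction t)
  case (Query i t0 t1)
  then show ?case by (auto intro: card_insert_le_m1 simp: card_insert_if)
qed simp

lemma run_cong_queried: "(\<And>i. i \<in> queried t f \<Longrightarrow> g i = f i) \<Longrightarrow> run t g = run t f"
  by (induction t) auto

lemma queried_subset: "dtree_on n t \<Longrightarrow> queried t f \<subseteq> {..<n}"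
  by (induction t) auto

text \<open>Deterministic trees are covered as well, through \<open>return_pmf\<close>.\<close>

lemma randomized_lower_bound:
  fixes p :: "dtree pmf"
  assumes "n > 0"
    and tree: "\<And>t. t \<in> set_pmf p \<Longrightarrow> dtree_on n t"
    and correct: "\<And>f. f \<in> inputs n \<Longrightarrow> measure_pmf.prob p {t. lseg_correct n f (run t f)} \<ge> 2 / 3"
    and bound: "\<And>t. t \<in> set_pmf p \<Longrightarrow> evaluations t (zero_input n) \<le> q"
  shows "real n / 3 \<le> real q"
proof -
  let ?z = "zero_input n"
  define Q where "Q j = {t. j \<in> queried t ?z}" for j
  have Q: "measure_pmf.prob p (Q j) \<ge> 1 / 3" if j: "j < n" for j
  proof -
    let ?A = "{t. lseg_correct n ?z (run t ?z)}"
    let ?B = "{t. lseg_correct n (point_input n j) (run t (point_input n j))}"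
    \<comment> \<open>A tree that is correct on both inputs must query \<open>j\<close> on the zero
      input. Up to a null set, \<open>?A\<close> therefore lies in \<open>- ?B \<union> Q j\<close>,
      and a union bound gives 2/3 \<le> 1/3 + prob(\<open>Q j\<close>).\<close>
    have "AE t in measure_pmf p. \<not> (t \<in> ?A \<and> t \<in> ?B \<and> t \<notin> Q j)"
    proof (rule AE_pmfI, rule notI)
      fix t assume t: "t \<in> set_pmf p" and *: "t \<in> ?A \<and> t \<in> ?B \<and> t \<notin> Q j"
      have "run t (point_input n j) = run t ?z"
      proof (rule run_cong_queried)
        fix i assume "i \<in> queried t ?z"
        moreover have "i < n" using queried_subset[OF tree[OF t]] calculation by auto
        ultimately show "point_input n j i = ?z i"
          using * by (auto simp: Q_def point_input_def zero_input_def)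
      qed
      then show False
        using * lseg_correct_zero_input[of n "run t ?z"] not_lseg_correct_point_input[OF j] \<open>n > 0\<close>
        by auto
    qed
    then have "measure_pmf.prob p ?A \<le> measure_pmf.prob p (- ?B \<union> Q j)"
      by (intro measure_pmf.finite_measure_mono_AE) auto
    also have "\<dots> \<le> measure_pmf.prob p (- ?B) + measure_pmf.prob p (Q j)"
      by (rule measure_Un_le) auto
    also have "measure_pmf.prob p (- ?B) = 1 - measure_pmf.prob p ?B"
      using measure_pmf.prob_compl[of ?B p] by (simp add: Compl_eq_Diff_UNIV)
    finally show ?thesis
      using correct[OF zero_input_in_inputs] correct[OF point_input_in_inputs, of j] by linarith
  qed
  \<comment> \<open>Double counting: the sum of the probabilities of \<open>Q j\<close> is the
    expected number of distinct positions queried on the zero input.\<close>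
  have "real n / 3 = (\<Sum>j<n. 1 / 3)" by simp
  also have "\<dots> \<le> (\<Sum>j<n. measure_pmf.prob p (Q j))"
    using Q by (intro sum_mono) auto
  also have "\<dots> = (\<Sum>j<n. measure_pmf.expectation p (indicator (Q j)))"
    by simp
  also have "\<dots> = measure_pmf.expectation p (\<lambda>t. \<Sum>j<n. indicator (Q j) t)"
    by (subst Bochner_Integration.integral_sum) (auto intro: measure_pmf.integrable_const_bound[where B = 1])
  also have "\<dots> \<le> measure_pmf.expectation p (\<lambda>t. real q)"
  proof (rule integral_mono_AE)
    show "AE t in measure_pmf p. (\<Sum>j<n. indicator (Q j) t) \<le> real q"
    proof (rule AE_pmfI)
      fix t assume t: "t \<in> set_pmf p"
      have "(\<Sum>j<n. indicator (Q j) t) = (\<Sum>j<n. indicator (queried t ?z) j :: real)"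
        by (intro sum.cong) (auto simp: Q_def indicator_def)
      also have "\<dots> = real (card ({..<n} \<inter> queried t ?z))"
        by (subst sum_indicator_eq_card[symmetric]) (simp_all add: of_nat_sum indicator_def)
      also have "\<dots> \<le> real (card (queried t ?z))"
        using card_queried_le by (simp add: card_mono)
      also have "\<dots> \<le> real q"
        using card_queried_le[of t ?z] bound[OF t] by simp
      finally show "(\<Sum>j<n. indicator (Q j) t) \<le> real q" .
    qed
  qed (auto intro!: Bochner_Integration.integrable_sum
      measure_pmf.integrable_const_bound[where B = 1])
  finally show ?thesis by simp
qed

section \<open>From algorithms to the classical complexities\<close>

lemma det_query_complexity_ge:
  assumes "n > 0" "c \<ge> 1"
  shows "real n / 3 \<le> real (det_query_complexity c n)"
proof -
  let ?q = "det_query_complexity c n"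
  obtain t where t: "dtree_on n t" "\<forall>f\<in>inputs n. lseg_correct n f (run t f)"
    "\<forall>f\<in>inputs n. c * evaluations t f \<le> ?q"
    using LeastI_ex[OF deterministic_algorithm_exists[of n c]]
    unfolding det_query_complexity_def by blast
  have "c * evaluations t (zero_input n) \<le> ?q"
    using t(3) zero_input_in_inputs by blast
  moreover have "evaluations t (zero_input n) \<le> c * evaluations t (zero_input n)"
    using \<open>c \<ge> 1\<close> by simp
  ultimately have "evaluations t (zero_input n) \<le> ?q" by linarith
  then show ?thesis
    using t(1,2) \<open>n > 0\<close> by (intro randomized_lower_bound[of n "return_pmf t"]) auto
qed

lemma rand_query_complexity_ge:
  assumes "n > 0" "c \<ge> 1"
  shows "real n / 3 \<le> real (rand_query_complexity c n)"
proof -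
  let ?q = "rand_query_complexity c n"
  \<comment> \<open>A point mass on an exact tree shows that the set under \<open>LEAST\<close> is
    nonempty.\<close>
  obtain q t where "dtree_on n t" "\<forall>f\<in>inputs n. lseg_correct n f (run t f)"
    "\<forall>f\<in>inputs n. c * evaluations t f \<le> q"
    using deterministic_algorithm_exists[of n c] by blast
  then have "\<exists>q. \<exists>p :: dtree pmf. (\<forall>t\<in>set_pmf p. dtree_on n t) \<and>
        (\<forall>f\<in>inputs n. measure_pmf.prob p {t. lseg_correct n f (run t f)} \<ge> 2 / 3) \<and>
        (\<forall>t\<in>set_pmf p. \<forall>f\<in>inputs n. c * evaluations t f \<le> q)"
    by (intro exI[of _ q] exI[of _ "return_pmf t"]) auto
  from LeastI_ex[OF this] obtain p :: "dtree pmf" where p: "\<forall>t\<in>set_pmf p. dtree_on n t"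
    "\<forall>f\<in>inputs n. measure_pmf.prob p {t. lseg_correct n f (run t f)} \<ge> 2 / 3"
    "\<forall>t\<in>set_pmf p. \<forall>f\<in>inputs n. c * evaluations t f \<le> ?q"
    unfolding rand_query_complexity_def by blast
  have "evaluations t (zero_input n) \<le> ?q" if "t \<in> set_pmf p" for t
  proof -
    have "c * evaluations t (zero_input n) \<le> ?q"
      using p(3) that zero_input_in_inputs by blast
    moreover have "evaluations t (zero_input n) \<le> c * evaluations t (zero_input n)"
      using \<open>c \<ge> 1\<close> by simp
    ultimately show ?thesis by linarith
  qed
  then show ?thesis
    using p(1,2) \<open>n > 0\<close> by (intro randomized_lower_bound[of n p]) auto
qed


section \<open>Permutation matrices and an exact quantum algorithm\<close>

definition perm_mat :: "nat \<Rightarrow> (nat \<Rightarrow> nat) \<Rightarrow> complex mat" where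
  "perm_mat N s = mat N N (\<lambda>(a, b). if a = s b then 1 else 0)"

lemma mat_adjoint_carrier:
  "A \<in> carrier_mat r c \<Longrightarrow> mat_adjoint A \<in> carrier_mat c r"
  unfolding mat_adjoint_def by auto

lemma mat_adjoint_index:
  fixes A :: "complex mat"
  assumes "A \<in> carrier_mat r c" "i < c" "j < r"
  shows "mat_adjoint A $$ (i, j) = cnj (A $$ (j, i))"
  using assms unfolding mat_adjoint_def by (auto simp: mat_of_rows_index)

lemma adjoint_mult_index:
  fixes A :: "complex mat"
  assumes "A \<in> carrier_mat N N" "i < N" "j < N"
  shows "(mat_adjoint A * A) $$ (i, j) = (\<Sum>a<N. cnj (A $$ (a, i)) * A $$ (a, j))"
  using assms mat_adjoint_carrier[OF assms(1)]
  by (auto simp: scalar_prod_def mat_adjoint_index atLeast0LessThan intro!: sum.cong)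

text \<open>The columns are distinct unit vectors, hence orthonormal; for square matrices a left
  inverse is also a right inverse.\<close>

lemma unitary_perm_mat:
  assumes s: "bij_betw s {..<N} {..<N}"
  shows "unitary_mat N (perm_mat N s)"
proof -
  let ?P = "perm_mat N s"
  have P: "?P \<in> carrier_mat N N" by (simp add: perm_mat_def)
  have eq: "mat_adjoint ?P * ?P = 1\<^sub>m N"
  proof (rule eq_matI)
    fix i j assume "i < dim_row (1\<^sub>m N :: complex mat)" "j < dim_col (1\<^sub>m N :: complex mat)"
    then have ij: "i < N" "j < N" by simp_all
    have si: "s i < N" using s ij(1) by (auto dest: bij_betwE)
    have "(mat_adjoint ?P * ?P) $$ (i, j) = (\<Sum>a<N. if a = s i then if s i = s j then 1 else 0 else 0)"
      unfolding adjoint_mult_index[OF P ij] using ij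
      by (intro sum.cong) (auto simp: perm_mat_def)
    also have "\<dots> = (if s i = s j then 1 else 0)" using si by simp
    also have "\<dots> = (if i = j then 1 else 0)"
      using s ij by (auto simp: bij_betw_def dest: inj_onD)
    finally show "(mat_adjoint ?P * ?P) $$ (i, j) = (1\<^sub>m N :: complex mat) $$ (i, j)"
      using ij by simp
  qed (use P mat_adjoint_carrier[OF P] in auto)
  moreover have "?P * mat_adjoint ?P = 1\<^sub>m N"
    using mat_mult_left_right_inverse[OF mat_adjoint_carrier[OF P] P eq] .
  ultimately show ?thesis using P by (simp add: unitary_mat_def)
qed

lemma perm_mat_mult_index:
  assumes s: "bij_betw s {..<N} {..<N}" and "b < N" "dim_vec v = N"
  shows "(perm_mat N s *\<^sub>v v) $ s b = v $ b"
proof -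
  have sb: "s b < N" using s \<open>b < N\<close> by (auto dest: bij_betwE)
  have "(perm_mat N s *\<^sub>v v) $ s b = (\<Sum>j<N. (if s b = s j then 1 else 0) * v $ j)"
    using sb assms(3) by (simp add: perm_mat_def scalar_prod_def atLeast0LessThan)
  also have "\<dots> = (\<Sum>j<N. if j = b then v $ j else 0)"
    using s \<open>b < N\<close> by (intro sum.cong) (auto simp: bij_betw_def dest: inj_onD)
  also have "\<dots> = v $ b" using \<open>b < N\<close> by simp
  finally show ?thesis .
qed

lemma perm_mat_unit_vec:
  assumes s: "bij_betw s {..<N} {..<N}" and "b < N"
  shows "perm_mat N s *\<^sub>v unit_vec N b = unit_vec N (s b)"
proof (rule eq_vecI)
  fix a assume "a < dim_vec (unit_vec N (s b) :: complex vec)"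
  then have "a \<in> s ` {..<N}" using s by (simp add: bij_betw_def)
  then obtain c where c: "a = s c" "c < N" by auto
  have "(s c = s b) = (c = b)"
    using s c \<open>b < N\<close> by (auto simp: bij_betw_def dest: inj_onD)
  moreover have "s c < N" "s b < N" using s c \<open>b < N\<close> by (auto dest: bij_betwE)
  ultimately show "(perm_mat N s *\<^sub>v unit_vec N b) $ a = unit_vec N (s b) $ a"
    using perm_mat_mult_index[OF s c(2), of "unit_vec N b"] c \<open>b < N\<close> by (simp add: unit_vec_def)
qed (simp add: perm_mat_def)

text \<open>Allows a reversible operation to be specified only on the basis states that occur: the
  complements of \<open>A\<close> and of its image have the same finite size, so any bijection
  between them completes \<open>g\<close>.\<close>

lemma inj_on_extends_to_bij:
  assumes "finite S" "A \<subseteq> S" "inj_on g A" "g ` A \<subseteq> S"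
  obtains s where "bij_betw s S S" "\<And>x. x \<in> A \<Longrightarrow> s x = g x"
proof -
  have "card (g ` A) = card A" using assms(3) by (rule card_image)
  then have "card (S - A) = card (S - g ` A)"
    using assms by (simp add: card_Diff_subset finite_subset)
  then obtain h where h: "bij_betw h (S - A) (S - g ` A)"
    using finite_same_card_bij assms(1) by (metis finite_Diff)
  let ?s = "\<lambda>x. if x \<in> A then g x else h x"
  have "bij_betw ?s (A \<union> (S - A)) (g ` A \<union> (S - g ` A))"
    using assms h by (intro bij_betw_disjoint_Un inj_on_imp_bij_betw) auto
  moreover have "A \<union> (S - A) = S" "g ` A \<union> (S - g ` A) = S" using assms by auto
  ultimately show ?thesis using that[of ?s] by simp
qed

section \<open>Binary encoding of inputs and the exact quantum algorithm\<close>

definition code :: "(nat \<Rightarrow> nat) \<Rightarrow> nat \<Rightarrow> nat" where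
  "code f k = (\<Sum>i<k. f i * 2 ^ i)"

lemma code_less:
  assumes "f \<in> inputs n" "k \<le> n"
  shows "code f k < 2 ^ k"
  using assms(2)
proof (induction k)
  case (Suc k)
  then have "f k \<in> {0, 1}" using assms(1) by (auto simp: inputs_def PiE_iff)
  then show ?case using Suc by (auto simp: code_def)
qed (simp add: code_def)

text \<open>The binary digits are peeled off from the top by \<open>div\<close> and
  \<open>mod\<close> with \<open>2 ^ k\<close>.\<close>

lemma code_inj:
  assumes "f \<in> inputs n" "g \<in> inputs n" "code f n = code g n"
  shows "f = g"
proof -
  have "code f k = code g k \<Longrightarrow> \<forall>i<k. f i = g i" if "k \<le> n" for k
    using that
  proof (induction k)
    case (Suc k)
    have "code f k = code f (Suc k) mod 2 ^ k" "code g k = code g (Suc k) mod 2 ^ k"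
      "f k = code f (Suc k) div 2 ^ k" "g k = code g (Suc k) div 2 ^ k"
      using code_less[OF assms(1), of k] code_less[OF assms(2), of k] Suc.prems(2)
      by (simp_all add: code_def)
    then have "code f k = code g k" "f k = g k" using Suc.prems by simp_all
    then show ?case using Suc by (simp add: less_Suc_eq)
  qed simp
  from this[of n] assms(3) have "\<And>i. i \<in> {..<n} \<Longrightarrow> f i = g i" by simp
  with assms(1,2) show ?thesis unfolding inputs_def by (rule PiE_ext)
qed

text \<open>
  The value of the queried bit is moved into the workspace, where bit \<open>k\<close> is still unused, and the
  index register is advanced to the next query.
\<close>

lemma store_bit_permutation_exists:
  assumes "k < n"
  shows "\<exists>s. bij_betw s {..<qdim n (2 ^ n)} {..<qdim n (2 ^ n)} \<and>
    (\<forall>z<2. \<forall>w<2 ^ k. s (basis_index (2 ^ n) k z w) =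
       basis_index (2 ^ n) (Suc k mod n) 0 (w + z * 2 ^ k))"
proof -
  let ?m = "2 ^ n :: nat"
  let ?b = "\<lambda>(z, w). basis_index ?m k z w"
  let ?c = "\<lambda>(z, w). basis_index ?m (Suc k mod n) 0 (w + z * 2 ^ k)"
  let ?D = "{..<2 :: nat} \<times> {..<2 ^ k :: nat}"
  have km: "(2 :: nat) * 2 ^ k \<le> ?m"
    using assms power_increasing[of "Suc k" n "2 :: nat"] by simp
  have wm: "w + z * 2 ^ k < ?m" "w < ?m" if "z < 2" "w < 2 ^ k" for z w :: nat
  proof -
    have "z * 2 ^ k \<le> 2 ^ k" using that(1) by (cases z) auto
    then show "w + z * 2 ^ k < ?m" "w < ?m" using that km by linarith+
  qed
  have inj_b: "inj_on ?b ?D"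
    using wm by (auto simp: inj_on_def basis_index_inject)
  have inj_c: "inj_on ?c ?D"
  proof -
    have "z = z' \<and> w = w'"
      if *: "z < 2" "w < 2 ^ k" "z' < 2" "w' < 2 ^ k"
        and eq: "basis_index ?m (Suc k mod n) 0 (w + z * 2 ^ k) =
          basis_index ?m (Suc k mod n) 0 (w' + z' * 2 ^ k)" for z w z' w' :: nat
    proof -
      from * eq have "w + z * 2 ^ k = w' + z' * 2 ^ k"
        using wm by (simp add: basis_index_inject)
      then have "(w + z * 2 ^ k) mod 2 ^ k = (w' + z' * 2 ^ k) mod 2 ^ k"
        "(w + z * 2 ^ k) div 2 ^ k = (w' + z' * 2 ^ k) div 2 ^ k" by simp_all
      then show ?thesis using * by simp
    qed
    then show ?thesis by (auto simp: inj_on_def)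
  qed
  \<comment> \<open>The prescribed partial map, sending \<open>?b x\<close> to \<open>?c x\<close>;
    it is well defined and injective because \<open>?b\<close> and \<open>?c\<close> are injective
    on \<open>?D\<close>.\<close>
  define g where "g = ?c \<circ> inv_into ?D ?b"
  have g: "g (?b x) = ?c x" if "x \<in> ?D" for x
    using that inj_b by (simp add: g_def inv_into_f_f)
  have "inj_on g (?b ` ?D)"
    unfolding g_def using inj_c
    by (intro comp_inj_on inj_on_inv_into) (simp_all add: inj_on_image_set_diff inv_into_image_cancel inj_b)
  moreover have "g ` ?b ` ?D \<subseteq> {..<qdim n ?m}"
  proof -
    have "?c x < qdim n ?m" if "x \<in> ?D" for x
      using that wm assms by (auto intro!: basis_index_less)
    then show ?thesis using g by fastforce
  qed
  moreover have "?b ` ?D \<subseteq> {..<qdim n ?m}"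
    using wm assms by (auto intro!: basis_index_less)
  ultimately obtain s where "bij_betw s {..<qdim n ?m} {..<qdim n ?m}"
    "\<And>x. x \<in> ?b ` ?D \<Longrightarrow> s x = g x"
    by (metis inj_on_extends_to_bij finite_lessThan)
  then show ?thesis
    using g by (intro exI[of _ s]) fastforce
qed

lemma quantum_algorithm_exists:
  assumes "n > 0"
  shows "\<exists>q m k U out. (\<forall>j\<le>k. unitary_mat (qdim n m) (U j)) \<and>
        (\<forall>f\<in>inputs n. success_prob n f out (qstate n m U f k) \<ge> 2 / 3) \<and>
        c * k \<le> q"
proof -
  let ?m = "2 ^ n :: nat"
  let ?N = "qdim n ?m"
  obtain s where s: "\<And>k. k < n \<Longrightarrow> bij_betw (s k) {..<?N} {..<?N}"
    and s_eq: "\<And>k z w. k < n \<Longrightarrow> z < 2 \<Longrightarrow> w < 2 ^ k \<Longrightarrow> s k (basis_index ?m k z w) =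
       basis_index ?m (Suc k mod n) 0 (w + z * 2 ^ k)"
    using store_bit_permutation_exists[of _ n] by metis
  \<comment> \<open>The start state already points at position 0, so \<open>U 0\<close> is the
    identity; \<open>U (Suc k)\<close> stores the value of position \<open>k\<close>.\<close>
  define U where "U = case_nat (perm_mat ?N id) (\<lambda>k. perm_mat ?N (s k))"
  have unitary: "unitary_mat ?N (U j)" if "j \<le> n" for j
    using that s by (auto simp: U_def intro!: unitary_perm_mat split: nat.split)
  \<comment> \<open>After the last query the index register wraps around to 0, hence
    \<open>k mod n\<close>.\<close>
  have state: "qstate n ?m U f k = unit_vec ?N (basis_index ?m (k mod n) 0 (code f k))"
    if f: "f \<in> inputs n" and "k \<le> n" for f k
    using \<open>k \<le> n\<close>
  proof (induction k)
    case 0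
    have "basis_index ?m 0 0 0 < ?N" using \<open>n > 0\<close> by (intro basis_index_less) auto
    then show ?case by (simp add: U_def perm_mat_unit_vec code_def)
  next
    case (Suc k)
    then have k: "k < n" by simp
    have fk: "f k < 2" using f k by (force simp: inputs_def PiE_iff)
    have w: "code f k < 2 ^ k" using code_less[OF f] k by simp
    also have "(2::nat) ^ k \<le> ?m" using k by (intro power_increasing) auto
    finally have w': "code f k < ?m" .
    have b: "basis_index ?m k (f k) (code f k) < ?N"
      using basis_index_less[OF k fk w'] .
    have "qstate n ?m U f (Suc k) =
        perm_mat ?N (s k) *\<^sub>v unit_vec ?N (basis_index ?m k (f k) (code f k))"
      using Suc k fk w' by (simp add: U_def query_op_unit_vec)
    also have "\<dots> = unit_vec ?N (basis_index ?m (Suc k mod n) 0 (code f k + f k * 2 ^ k))"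
      using perm_mat_unit_vec[OF s[OF k] b] s_eq[OF k fk w] by simp
    finally show ?case by (simp add: code_def)
  qed
  \<comment> \<open>The choice is safe: by \<open>code_inj\<close> at most one input leads to the
    measured basis state.\<close>
  define out where "out b = (SOME a. \<exists>f\<in>inputs n. b = basis_index ?m 0 0 (code f n) \<and>
      lseg_correct n f a)" for b
  have out: "lseg_correct n f (out (basis_index ?m 0 0 (code f n)))" if f: "f \<in> inputs n" for f
  proof -
    let ?b = "basis_index ?m 0 0 (code f n)"
    have "\<exists>g\<in>inputs n. ?b = basis_index ?m 0 0 (code g n) \<and> lseg_correct n g (out ?b)"
      unfolding out_def by (rule someI_ex) (use f lseg_correct_exists in blast)
    then obtain g where g: "g \<in> inputs n" "?b = basis_index ?m 0 0 (code g n)"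
      "lseg_correct n g (out ?b)" by blast
    have "code f n = code g n"
      using g(2) code_less[OF f order_refl] code_less[OF g(1) order_refl]
      by (simp add: basis_index_inject)
    then show ?thesis using g code_inj[OF f g(1)] by simp
  qed
  have "success_prob n f out (qstate n ?m U f n) \<ge> 2 / 3" if f: "f \<in> inputs n" for f
  proof -
    let ?b = "basis_index ?m 0 0 (code f n)"
    let ?v = "unit_vec ?N ?b :: complex vec"
    have b: "?b < ?N" using code_less[OF f order_refl] \<open>n > 0\<close> by (intro basis_index_less) auto
    have "1 = (\<Sum>b\<in>{?b}. (cmod (?v $ b))\<^sup>2)" using b by simp
    also have "\<dots> \<le> success_prob n f out ?v"
      unfolding success_prob_def by (rule sum_mono2) (use b out[OF f] in auto)
    finally show ?thesis using state[OF f order_refl] by simp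
  qed
  then show ?thesis
    using unitary by (intro exI[of _ "c * n"] exI[of _ ?m] exI[of _ n] exI[of _ U] exI[of _ out]) auto
qed


section \<open>The hybrid argument\<close>

definition vnorm :: "complex vec \<Rightarrow> real" where
  "vnorm v = L2_set (\<lambda>b. cmod (v $ b)) {..<dim_vec v}"

text \<open>The index set is arbitrary because the inequality serves both the whole space, in
  \<open>vnorm_triangle\<close>, and a set of measurement outcomes, in
  \<open>states_far_apart\<close>.\<close>

lemma L2_set_cmod_diff_le:
  "L2_set (\<lambda>b. cmod (f b)) A \<le> L2_set (\<lambda>b. cmod (g b)) A + L2_set (\<lambda>b. cmod (f b - g b)) A"
proof -
  have "L2_set (\<lambda>b. cmod (f b)) A \<le> L2_set (\<lambda>b. cmod (g b) + cmod (f b - g b)) A"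
    by (rule L2_set_mono) (simp_all add: norm_triangle_sub)
  also have "\<dots> \<le> L2_set (\<lambda>b. cmod (g b)) A + L2_set (\<lambda>b. cmod (f b - g b)) A"
    by (rule L2_set_triangle_ineq)
  finally show ?thesis .
qed

lemma vnorm_triangle:
  assumes "dim_vec u = N" "dim_vec v = N" "dim_vec w = N"
  shows "vnorm (u - w) \<le> vnorm (u - v) + vnorm (v - w)"
proof -
  have "vnorm (u - w) \<le> vnorm (v - w) + vnorm (u - v)"
    using assms L2_set_cmod_diff_le[of "\<lambda>b. (u - w) $ b" "{..<N}" "\<lambda>b. (v - w) $ b"]
    by (simp add: vnorm_def cong: L2_set_cong_simp)
  then show ?thesis by simp
qed

text \<open>Expand the squared norm of \<open>U *\<^sub>v v\<close> into a triple sum and sum over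
  the row index first: orthonormality of the columns leaves only the diagonal terms.\<close>

lemma vnorm_unitary:
  assumes U: "unitary_mat N U" and v: "dim_vec v = N"
  shows "vnorm (U *\<^sub>v v) = vnorm v"
proof -
  have A: "U \<in> carrier_mat N N" and UU: "mat_adjoint U * U = 1\<^sub>m N"
    using U by (auto simp: unitary_mat_def)
  have delta: "(\<Sum>a<N. cnj (U $$ (a, i)) * U $$ (a, j)) = (if i = j then 1 else 0)"
    if "i < N" "j < N" for i j
    using adjoint_mult_index[OF A that] that by (simp add: UU)
  have Uv: "(U *\<^sub>v v) $ a = (\<Sum>j<N. U $$ (a, j) * v $ j)" if "a < N" for a
    using that A v by (auto simp: scalar_prod_def atLeast0LessThan intro!: sum.cong)
  have "complex_of_real (\<Sum>a<N. (cmod ((U *\<^sub>v v) $ a))\<^sup>2) =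
      (\<Sum>a<N. (\<Sum>j<N. U $$ (a, j) * v $ j) * cnj (\<Sum>i<N. U $$ (a, i) * v $ i))"
    by (simp add: Uv complex_norm_square del: cnj_sum of_real_power)
  also have "\<dots> = (\<Sum>a<N. \<Sum>j<N. \<Sum>i<N. v $ j * cnj (v $ i) * (cnj (U $$ (a, i)) * U $$ (a, j)))"
    by (simp add: sum_product mult_ac)
  also have "\<dots> = (\<Sum>j<N. \<Sum>i<N. \<Sum>a<N. v $ j * cnj (v $ i) * (cnj (U $$ (a, i)) * U $$ (a, j)))"
    by (subst sum.swap) (intro sum.cong refl sum.swap)
  also have "\<dots> = (\<Sum>j<N. \<Sum>i<N. v $ j * cnj (v $ i) * (if i = j then 1 else 0))"
    by (intro sum.cong refl) (simp add: delta flip: sum_distrib_left)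
  also have "\<dots> = (\<Sum>j<N. v $ j * cnj (v $ j))"
    by (intro sum.cong refl) (simp add: if_distrib cong: if_cong)
  also have "\<dots> = complex_of_real (\<Sum>a<N. (cmod (v $ a))\<^sup>2)"
    by (simp add: complex_norm_square del: of_real_power)
  finally have "(\<Sum>a<N. (cmod ((U *\<^sub>v v) $ a))\<^sup>2) = (\<Sum>a<N. (cmod (v $ a))\<^sup>2)"
    by (simp only: of_real_eq_iff)
  then show ?thesis using A v by (simp add: vnorm_def L2_set_def)
qed

section \<open>The query operator as a self-inverse permutation of the basis\<close>

definition reg :: "nat \<Rightarrow> nat \<Rightarrow> nat" where
  "reg m b = b div m div 2"

text \<open>For \<open>b = basis_index m i z w\<close> with \<open>z < 2\<close> and
  \<open>w < m\<close>, \<open>reg m b\<close> is \<open>i\<close>, and \<open>b div m\<close> is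
  \<open>i * 2 + z\<close>, which may stand for \<open>z\<close> since only its parity
  matters.\<close>

definition query_perm :: "nat \<Rightarrow> (nat \<Rightarrow> nat) \<Rightarrow> nat \<Rightarrow> nat" where
  "query_perm m f b = basis_index m (reg m b) ((b div m + f (reg m b)) mod 2) (b mod m)"

lemma basis_index_decomp:
  assumes "b < qdim n m"
  shows "reg m b < n" "b mod m < m" "basis_index m (reg m b) (b div m mod 2) (b mod m) = b"
proof -
  have "m > 0" using assms by (cases m) (auto simp: qdim_def)
  then show "b mod m < m" by simp
  have "b div m < n * 2"
    using assms by (simp add: qdim_def less_mult_imp_div_less)
  then show "reg m b < n" by (simp add: reg_def)
  have "b div m div 2 * 2 + b div m mod 2 = b div m" by presburger
  then show "basis_index m (reg m b) (b div m mod 2) (b mod m) = b"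
    by (simp add: basis_index_def reg_def)
qed

lemma basis_index_coords:
  assumes "z < 2" "w < m"
  shows "reg m (basis_index m i z w) = i" "basis_index m i z w div m mod 2 = z"
    "basis_index m i z w mod m = w"
  using assms by (simp_all add: reg_def basis_index_def)

lemma query_perm_basis_index:
  assumes "z < 2" "w < m"
  shows "query_perm m f (basis_index m i z w) = basis_index m i ((z + f i) mod 2) w"
  using assms basis_index_coords[OF assms, of i]
  by (simp add: query_perm_def) (metis mod_add_left_eq)

text \<open>The index register is left alone, so both applications add the same value
  \<open>f i\<close>, and twice \<open>f i\<close> vanishes modulo 2.\<close>

lemma query_perm:
  assumes "b < qdim n m"
  shows "query_perm m f b < qdim n m" "reg m (query_perm m f b) = reg m b"
    "query_perm m f (query_perm m f b) = b"
proof -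
  note d = basis_index_decomp[OF assms]
  show "query_perm m f b < qdim n m"
    unfolding query_perm_def using d by (intro basis_index_less) auto
  show "reg m (query_perm m f b) = reg m b"
    unfolding query_perm_def using d by (intro basis_index_coords) auto
  have "((x + y) mod 2 + y) mod 2 = x mod 2" for x y :: nat by presburger
  from this[of "b div m" "f (reg m b)"] have
    "((b div m + f (reg m b)) mod 2 + f (reg m b)) mod 2 = b div m mod 2" .
  then show "query_perm m f (query_perm m f b) = b"
    using d query_perm_basis_index[of "(b div m + f (reg m b)) mod 2" "b mod m" m f "reg m b"]
    by (simp add: query_perm_def[of m f b])
qed

lemma bij_query_perm: "bij_betw (query_perm m f) {..<qdim n m} {..<qdim n m}"
  by (rule bij_betwI[where g = "query_perm m f"]) (auto simp: query_perm)

lemma query_op_eq_perm_mat: "query_op n m f = perm_mat (qdim n m) (query_perm m f)"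
proof (rule eq_matI)
  fix a b assume "a < dim_row (perm_mat (qdim n m) (query_perm m f))"
    "b < dim_col (perm_mat (qdim n m) (query_perm m f))"
  then have ab: "a < qdim n m" "b < qdim n m" by (simp_all add: perm_mat_def)
  have "(\<exists>i<n. \<exists>z<2. \<exists>w<m. b = basis_index m i z w \<and> a = basis_index m i ((z + f i) mod 2) w)
      \<longleftrightarrow> a = query_perm m f b"
  proof
    assume a: "a = query_perm m f b"
    note d = basis_index_decomp[OF ab(2)]
    show "\<exists>i<n. \<exists>z<2. \<exists>w<m. b = basis_index m i z w \<and> a = basis_index m i ((z + f i) mod 2) w"
      using d a by (intro exI[of _ "reg m b"] exI[of _ "b div m mod 2"] exI[of _ "b mod m"] conjI)
        (simp_all add: query_perm_def mod_add_left_eq)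
  qed (auto simp: query_perm_basis_index)
  then show "query_op n m f $$ (a, b) = perm_mat (qdim n m) (query_perm m f) $$ (a, b)"
    using ab by (simp add: query_op_def perm_mat_def)
qed (simp_all add: query_op_def perm_mat_def)

lemma unitary_query_op: "unitary_mat (qdim n m) (query_op n m f)"
  unfolding query_op_eq_perm_mat by (rule unitary_perm_mat) (rule bij_query_perm)

text \<open>A permutation matrix moves coordinates by the inverse permutation, which here is the
  permutation itself.\<close>

lemma query_op_mult_index:
  assumes "b < qdim n m" "dim_vec v = qdim n m"
  shows "(query_op n m f *\<^sub>v v) $ b = v $ query_perm m f b"
  using perm_mat_mult_index[OF bij_query_perm query_perm(1)[OF assms(1)] assms(2), of f f]
  by (simp add: query_op_eq_perm_mat query_perm[OF assms(1)])

text \<open>The norm of the projection of \<open>v\<close> onto the states that query position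
  \<open>i\<close>, called the amplitude at an index above.\<close>

definition reg_weight :: "nat \<Rightarrow> nat \<Rightarrow> complex vec \<Rightarrow> real" where
  "reg_weight m i v = L2_set (\<lambda>b. cmod (v $ b)) {b. b < dim_vec v \<and> reg m b = i}"

text \<open>Oracles that differ only at \<open>i\<close> agree on all basis states whose index register is not \<open>i\<close>.\<close>

lemma query_op_diff_le:
  assumes v: "dim_vec v = qdim n m" and fg: "\<And>j. j < n \<Longrightarrow> j \<noteq> i \<Longrightarrow> f j = g j"
  shows "vnorm (query_op n m f *\<^sub>v v - query_op n m g *\<^sub>v v) \<le> 2 * reg_weight m i v"
proof -
  let ?N = "qdim n m"
  let ?R = "{b. b < ?N \<and> reg m b = i}"
  have dims: "dim_vec (query_op n m h *\<^sub>v v) = ?N" for h by (simp add: query_op_def)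
  \<comment> \<open>\<open>query_perm\<close> preserves the index register and so permutes
    \<open>?R\<close>.\<close>
  have perm: "L2_set (\<lambda>b. cmod (v $ query_perm m h b)) ?R = reg_weight m i v" for h
  proof -
    have "bij_betw (query_perm m h) ?R ?R"
      by (rule bij_betwI[where g = "query_perm m h"]) (auto simp: query_perm)
    from sum.reindex_bij_betw[OF this, of "\<lambda>b. (cmod (v $ b))\<^sup>2"]
    show ?thesis by (simp add: reg_weight_def L2_set_def v)
  qed
  have "vnorm (query_op n m f *\<^sub>v v - query_op n m g *\<^sub>v v) =
      L2_set (\<lambda>b. cmod (v $ query_perm m f b - v $ query_perm m g b)) {..<?N}"
    unfolding vnorm_def using dims
    by (intro L2_set_cong) (auto simp: query_op_mult_index[OF _ v] simp del: index_mult_mat_vec)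
  also have "\<dots> = L2_set (\<lambda>b. cmod (v $ query_perm m f b - v $ query_perm m g b)) ?R"
    unfolding L2_set_def
  proof (rule arg_cong[where f = sqrt], rule sum.mono_neutral_right)
    show "\<forall>b\<in>{..<?N} - ?R. (cmod (v $ query_perm m f b - v $ query_perm m g b))\<^sup>2 = 0"
      using fg basis_index_decomp(1) by (auto simp: query_perm_def)
  qed auto
  \<comment> \<open>Each of the two oracles contributes one \<open>reg_weight m i v\<close>, hence
    the factor 2.\<close>
  also have "\<dots> \<le> L2_set (\<lambda>b. cmod (v $ query_perm m f b) + cmod (v $ query_perm m g b)) ?R"
    by (rule L2_set_mono) (auto simp: norm_triangle_ineq4)
  also have "\<dots> \<le> 2 * reg_weight m i v"
    using L2_set_triangle_ineq[of "\<lambda>b. cmod (v $ query_perm m f b)" "\<lambda>b. cmod (v $ query_perm m g b)" ?R]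
    by (simp add: perm)
  finally show ?thesis .
qed

lemma dim_qstate:
  assumes "\<forall>j\<le>k. unitary_mat (qdim n m) (U j)"
  shows "dim_vec (qstate n m U f k) = qdim n m"
  using assms by (cases k) (auto simp: unitary_mat_def)

text \<open>An inequality, because for \<open>m = 0\<close> the space is trivial and the start
  vector has norm 0.\<close>

lemma vnorm_qstate_le:
  assumes "\<forall>j\<le>k. unitary_mat (qdim n m) (U j)"
  shows "vnorm (qstate n m U f k) \<le> 1"
  using assms
proof (induction k)
  case 0
  have "(\<Sum>b<qdim n m. (cmod (unit_vec (qdim n m) 0 $ b))\<^sup>2) =
      (\<Sum>b<qdim n m. if b = 0 then 1 else 0)"
    by (intro sum.cong) (auto simp: unit_vec_def)
  also have "\<dots> \<le> 1" by simp
  finally have "vnorm (unit_vec (qdim n m) 0) \<le> 1"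
    by (simp add: vnorm_def L2_set_def)
  then show ?case using 0 by (simp add: vnorm_unitary basis_index_def)
next
  case (Suc k)
  have "dim_vec (query_op n m f *\<^sub>v qstate n m U f k) = qdim n m" by (simp add: query_op_def)
  then show ?case
    using Suc dim_qstate[of k n m U f]
    by (simp add: vnorm_unitary[of "qdim n m"] unitary_query_op)
qed

text \<open>The intermediate vector \<open>?G *\<^sub>v ?u\<close> applies the other oracle to the
  state of the run on \<open>f\<close>. Only weights of that run then occur, and with the zero input
  as \<open>f\<close> they are the same for every marked position \<open>i\<close>.\<close>

lemma hybrid_bound:
  assumes "\<forall>j\<le>k. unitary_mat (qdim n m) (U j)"
    and fg: "\<And>j. j < n \<Longrightarrow> j \<noteq> i \<Longrightarrow> f j = g j"
  shows "vnorm (qstate n m U f k - qstate n m U g k) \<le> (\<Sum>t<k. 2 * reg_weight m i (qstate n m U f t))"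
  using assms(1)
proof (induction k)
  case 0
  have "dim_vec (qstate n m U f 0) = qdim n m" using 0 by (rule dim_qstate)
  then show ?case by (simp add: vnorm_def L2_set_def)
next
  case (Suc k)
  let ?N = "qdim n m"
  let ?u = "qstate n m U f k" and ?v = "qstate n m U g k"
  let ?F = "query_op n m f" and ?G = "query_op n m g"
  have UF: "U (Suc k) \<in> carrier_mat ?N ?N" using Suc.prems by (simp add: unitary_mat_def)
  have car: "?F \<in> carrier_mat ?N ?N" "?G \<in> carrier_mat ?N ?N" by (simp_all add: query_op_def)
  have dims: "dim_vec ?u = ?N" "dim_vec ?v = ?N" using Suc.prems by (simp_all add: dim_qstate)
  have vc: "?u \<in> carrier_vec ?N" "?v \<in> carrier_vec ?N"
    using dims by (auto intro: carrier_vecI)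
  have "vnorm (qstate n m U f (Suc k) - qstate n m U g (Suc k)) =
      vnorm (U (Suc k) *\<^sub>v (?F *\<^sub>v ?u - ?G *\<^sub>v ?v))"
    using mult_minus_distrib_mat_vec[OF UF, of "?F *\<^sub>v ?u" "?G *\<^sub>v ?v"] car vc by simp
  also have "\<dots> = vnorm (?F *\<^sub>v ?u - ?G *\<^sub>v ?v)"
    using Suc.prems car by (intro vnorm_unitary[of ?N]) auto
  also have "\<dots> \<le> vnorm (?F *\<^sub>v ?u - ?G *\<^sub>v ?u) + vnorm (?G *\<^sub>v ?u - ?G *\<^sub>v ?v)"
    using car by (intro vnorm_triangle[of _ ?N]) auto
  also have "?G *\<^sub>v ?u - ?G *\<^sub>v ?v = ?G *\<^sub>v (?u - ?v)"
    using mult_minus_distrib_mat_vec[OF car(2) vc] by simp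
  also have "vnorm \<dots> = vnorm (?u - ?v)"
    using dims by (intro vnorm_unitary[of ?N] unitary_query_op) auto
  also have "vnorm (?F *\<^sub>v ?u - ?G *\<^sub>v ?u) \<le> 2 * reg_weight m i ?u"
    using query_op_diff_le[OF dims(1) fg] by simp
  finally show ?case using Suc by simp
qed

text \<open>The value of the index register partitions the basis states.\<close>

lemma sum_reg_weight_le:
  assumes "dim_vec v = qdim n m"
  shows "(\<Sum>i<n. (reg_weight m i v)\<^sup>2) \<le> (vnorm v)\<^sup>2"
proof -
  have "(\<Sum>i<n. (reg_weight m i v)\<^sup>2) =
      (\<Sum>i<n. \<Sum>b\<in>{b\<in>{..<qdim n m}. reg m b = i}. (cmod (v $ b))\<^sup>2)"
    by (simp add: reg_weight_def L2_set_def assms sum_nonneg)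
  also have "\<dots> = (\<Sum>b<qdim n m. (cmod (v $ b))\<^sup>2)"
    by (rule sum.group) (auto simp: basis_index_decomp(1))
  also have "\<dots> = (vnorm v)\<^sup>2"
    by (simp add: vnorm_def L2_set_def assms sum_nonneg)
  finally show ?thesis by simp
qed

section \<open>Distinguishing the final states, and the quantum bound\<close>

lemma success_prob_le:
  assumes "\<And>b. lseg_correct n f (out b) \<Longrightarrow> b \<in> B"
  shows "success_prob n f out v \<le> (\<Sum>b\<in>{b\<in>B. b < dim_vec v}. (cmod (v $ b))\<^sup>2)"
  unfolding success_prob_def using assms by (intro sum_mono2) auto

text \<open>Let \<open>A\<close> be the set of outcomes reported as the whole interval. The mass on
  \<open>A\<close> is at least 2/3 for \<open>u\<close> and at most 1/3 for \<open>v\<close>; the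
  norms restricted to \<open>A\<close> then differ by at least the stated gap.\<close>

lemma states_far_apart:
  assumes dims: "dim_vec u = N" "dim_vec v = N" and "n > 0" "i < n" and norm: "vnorm v \<le> 1"
    and u: "success_prob n (zero_input n) out u \<ge> 2 / 3"
    and v: "success_prob n (point_input n i) out v \<ge> 2 / 3"
  shows "sqrt (2 / 3) - sqrt (1 / 3) \<le> vnorm (u - v)"
proof -
  define B where "B = {b. out b = Some (0, n - 1)}"
  define A where "A = {b \<in> B. b < N}"
  have A: "A \<subseteq> {..<N}" "finite A" by (auto simp: A_def)
  have "2 / 3 \<le> (\<Sum>b\<in>A. (cmod (u $ b))\<^sup>2)"
    using u success_prob_le[of n "zero_input n" out B u] lseg_correct_zero_input[of n] \<open>n > 0\<close> dims
    by (force simp: A_def B_def)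
  then have *: "sqrt (2 / 3) \<le> L2_set (\<lambda>b. cmod (u $ b)) A"
    unfolding L2_set_def by (rule real_sqrt_le_mono)
  \<comment> \<open>The whole interval is wrong for the point input, so the correct mass lies
    outside \<open>A\<close>; as the total mass is at most 1, at most 1/3 is left on
    \<open>A\<close>.\<close>
  have "2 / 3 \<le> (\<Sum>b\<in>{b \<in> - B. b < dim_vec v}. (cmod (v $ b))\<^sup>2)"
    using v success_prob_le[of n "point_input n i" out "- B" v] not_lseg_correct_point_input[OF \<open>i < n\<close>]
    by (force simp: B_def)
  also have "{b \<in> - B. b < dim_vec v} = {..<N} - A" using dims by (auto simp: A_def)
  also have "(\<Sum>b\<in>{..<N} - A. (cmod (v $ b))\<^sup>2) = (\<Sum>b<N. (cmod (v $ b))\<^sup>2) - (\<Sum>b\<in>A. (cmod (v $ b))\<^sup>2)"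
    using A by (intro sum_diff) auto
  also have "(\<Sum>b<N. (cmod (v $ b))\<^sup>2) = (vnorm v)\<^sup>2"
    by (simp add: vnorm_def L2_set_def dims sum_nonneg)
  also have "\<dots> \<le> 1"
    using norm by (simp add: vnorm_def power_le_one)
  finally have "(\<Sum>b\<in>A. (cmod (v $ b))\<^sup>2) \<le> 1 / 3" by simp
  then have "L2_set (\<lambda>b. cmod (v $ b)) A \<le> sqrt (1 / 3)"
    unfolding L2_set_def by (rule real_sqrt_le_mono)
  moreover have "L2_set (\<lambda>b. cmod (u $ b - v $ b)) A \<le> vnorm (u - v)"
    unfolding vnorm_def L2_set_def using A dims
    by (intro real_sqrt_le_mono) (simp add: sum_mono2)
  ultimately show ?thesis
    using * L2_set_cmod_diff_le[of "\<lambda>b. u $ b" A "\<lambda>b. v $ b"] by linarith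
qed

lemma quantum_lower_bound:
  assumes "n > 0" and U: "\<forall>j\<le>k. unitary_mat (qdim n m) (U j)"
    and correct: "\<And>f. f \<in> inputs n \<Longrightarrow> success_prob n f out (qstate n m U f k) \<ge> 2 / 3"
  shows "(sqrt (2 / 3) - sqrt (1 / 3)) / 2 * sqrt (real n) \<le> real k"
proof -
  define d :: real where "d = sqrt (2 / 3) - sqrt (1 / 3)"
  have d: "d \<ge> 0" by (simp add: d_def)
  define w where "w i t = reg_weight m i (qstate n m U (zero_input n) t)" for i t
  have w_sum: "(\<Sum>i<n. (w i t)\<^sup>2) \<le> 1" if "t < k" for t
  proof -
    have Ut: "\<forall>j\<le>t. unitary_mat (qdim n m) (U j)" using U that by auto
    have "(\<Sum>i<n. (w i t)\<^sup>2) \<le> (vnorm (qstate n m U (zero_input n) t))\<^sup>2"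
      unfolding w_def by (rule sum_reg_weight_le) (rule dim_qstate[OF Ut])
    also have "\<dots> \<le> 1"
      using vnorm_qstate_le[OF Ut] by (simp add: vnorm_def power_le_one)
    finally show ?thesis .
  qed
  have "d\<^sup>2 \<le> 4 * k * (\<Sum>t<k. (w i t)\<^sup>2)" if "i < n" for i
  proof -
    have "d \<le> vnorm (qstate n m U (zero_input n) k - qstate n m U (point_input n i) k)"
      unfolding d_def
      using correct zero_input_in_inputs point_input_in_inputs that \<open>n > 0\<close> U
      by (intro states_far_apart[where N = "qdim n m"]) (auto simp: dim_qstate vnorm_qstate_le)
    also have "\<dots> \<le> (\<Sum>t<k. 2 * w i t)"
      unfolding w_def using U
      by (rule hybrid_bound) (auto simp: zero_input_def point_input_def)
    finally have "d\<^sup>2 \<le> (\<Sum>t<k. 2 * w i t)\<^sup>2" using d by (intro power_mono) auto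
    also have "\<dots> = 4 * (\<Sum>t<k. w i t)\<^sup>2"
      by (simp add: power_mult_distrib flip: sum_distrib_left)
    \<comment> \<open>Cauchy-Schwarz against the constant 1 over the \<open>k\<close>
      queries.\<close>
    also have "\<dots> \<le> 4 * (k * (\<Sum>t<k. (w i t)\<^sup>2))"
      using Cauchy_Schwarz_ineq_sum[of "\<lambda>_. 1" "w i" "{..<k}"] by simp
    finally show ?thesis by simp
  qed
  then have "(\<Sum>i<n. d\<^sup>2) \<le> (\<Sum>i<n. 4 * k * (\<Sum>t<k. (w i t)\<^sup>2))"
    by (intro sum_mono) auto
  \<comment> \<open>After the swap, each query has total squared weight at most 1 over all
    positions, which leaves \<open>4 * k * k\<close>.\<close>
  also have "\<dots> = 4 * k * (\<Sum>t<k. \<Sum>i<n. (w i t)\<^sup>2)"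
    by (subst sum.swap) (simp add: sum_distrib_left)
  also have "\<dots> \<le> real (4 * k) * (\<Sum>t<k. 1)"
    by (intro mult_left_mono sum_mono) (use w_sum in auto)
  also have "\<dots> = (2 * real k)\<^sup>2" by (simp add: power2_eq_square)
  finally have "(d * sqrt n)\<^sup>2 \<le> (2 * real k)\<^sup>2"
    by (simp add: power_mult_distrib mult.commute)
  then have "d * sqrt n \<le> 2 * real k" by (rule power2_le_imp_le) simp
  then show ?thesis by (simp add: d_def)
qed

lemma quantum_query_complexity_ge:
  assumes "n > 0" "c \<ge> 1"
  shows "(sqrt (2 / 3) - sqrt (1 / 3)) / 2 * sqrt (real n) \<le> real (quantum_query_complexity c n)"
proof -
  let ?q = "quantum_query_complexity c n"
  obtain m k U out where alg: "\<forall>j\<le>k. unitary_mat (qdim n m) (U j)"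
    "\<forall>f\<in>inputs n. success_prob n f out (qstate n m U f k) \<ge> 2 / 3" "c * k \<le> ?q"
    using LeastI_ex[OF quantum_algorithm_exists[OF \<open>n > 0\<close>, of c]]
    unfolding quantum_query_complexity_def by blast
  have "k \<le> c * k" using \<open>c \<ge> 1\<close> by simp
  then have "real k \<le> real ?q" using alg(3) by linarith
  moreover have "(sqrt (2 / 3) - sqrt (1 / 3)) / 2 * sqrt (real n) \<le> real k"
    using quantum_lower_bound[OF \<open>n > 0\<close> alg(1)] alg(2) by blast
  ultimately show ?thesis by linarith
qed

theorem theorem2:
  fixes T_f :: "nat \<Rightarrow> nat"
  assumes "\<And>n. T_f n \<ge> 1"
    and "(\<lambda>n. real (T_f n)) \<in> O(\<lambda>_. 1)"
  shows "(\<lambda>n. real (det_query_complexity (T_f n) n)) \<in> \<Omega>(\<lambda>n. real n) \<and>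
    (\<lambda>n. real (rand_query_complexity (T_f n) n)) \<in> \<Omega>(\<lambda>n. real n) \<and>
    (\<lambda>n. real (quantum_query_complexity (T_f n) n)) \<in> \<Omega>(\<lambda>n. sqrt (real n))"
proof (intro conjI)
  show "(\<lambda>n. real (det_query_complexity (T_f n) n)) \<in> \<Omega>(\<lambda>n. real n)"
    using det_query_complexity_ge[OF _ assms(1)]
    by (intro landau_omega.bigI[of "1 / 3"] eventually_mono[OF eventually_gt_at_top[of 0]]) auto
  show "(\<lambda>n. real (rand_query_complexity (T_f n) n)) \<in> \<Omega>(\<lambda>n. real n)"
    using rand_query_complexity_ge[OF _ assms(1)]
    by (intro landau_omega.bigI[of "1 / 3"] eventually_mono[OF eventually_gt_at_top[of 0]]) auto
  \<comment> \<open>The constant is positive because 1/3 < 2/3.\<close>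
  show "(\<lambda>n. real (quantum_query_complexity (T_f n) n)) \<in> \<Omega>(\<lambda>n. sqrt (real n))"
    using quantum_query_complexity_ge[OF _ assms(1)]
    by (intro landau_omega.bigI[of "(sqrt (2 / 3) - sqrt (1 / 3)) / 2"]
        eventually_mono[OF eventually_gt_at_top[of 0]]) auto
qed

end
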